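(* There is no non-square integer $d>1$ for which the equation $$X_l=2^{n_1}3^{n_2},\qquad n_1\le n_2,$$ in integers $l\ge 1$ and $n_1,n_2\ge 0$, has at least two solutions $(l,n_1,n_2)$, where $(X_l)_{l\ge 1}$ denotes the sequence of $X$-coordinates of the positive integer solutions of the Pell equation $X^2-dY^2=1$.
   Context: For a non-square integer $d>1$, let $(X_1,Y_1)$ be the smallest positive integer solution of the Pell equation $X^2-dY^2=1$. All positive integer solutions are $(X_l,Y_l)$, $l\ge 1$, where $X_l+Y_l\sqrt d=(X_1+Y_1\sqrt d)^l$. The sequence satisfies $X_l=2X_1X_{l-1}-X_{l-2}$ for $l\ge 2$, with $X_0=1$. *)

theory Defs
  imports Complex_Main "HOL-Computational_Algebra.Nth_Powers"
begin

definition pell_solution :: "int \<Rightarrow> int \<Rightarrow> int \<Rightarrow> bool" where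
  "pell_solution d x y \<longleftrightarrow> x > 0 \<and> y > 0 \<and> x\<^sup>2 - d * y\<^sup>2 = 1"

text \<open>Among positive solutions \<open>x\<close> and \<open>y\<close> increase together, so the smallest
  solution is smallest in both coordinates.\<close>

definition pell_fundamental :: "int \<Rightarrow> int \<Rightarrow> int \<Rightarrow> bool" where
  "pell_fundamental d x y \<longleftrightarrow>
     pell_solution d x y \<and> (\<forall>x' y'. pell_solution d x' y' \<longrightarrow> x \<le> x' \<and> y \<le> y')"

text \<open>For non-square \<open>d > 1\<close> exactly one pair of integer sequences satisfies this predicate:
  a smallest solution exists (Lagrange), and \<open>sqrt d\<close> is irrational.
  The index 0 is included, with \<open>X 0 = 1\<close> and \<open>Y 0 = 0\<close>.\<close>

definition pell_sequence :: "int \<Rightarrow> (nat \<Rightarrow> int) \<Rightarrow> (nat \<Rightarrow> int) \<Rightarrow> bool" where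
  "pell_sequence d X Y \<longleftrightarrow>
     pell_fundamental d (X 1) (Y 1) \<and>
     (\<forall>l. of_int (X l) + of_int (Y l) * sqrt (of_int d)
            = (of_int (X 1) + of_int (Y 1) * sqrt (of_int d)) ^ l)"

definition solutions_23 :: "(nat \<Rightarrow> int) \<Rightarrow> (nat \<times> nat \<times> nat) set" where
  "solutions_23 X = {(l, n1, n2). l \<ge> 1 \<and> n1 \<le> n2 \<and> X l = 2 ^ n1 * 3 ^ n2}"

end

theory Submission
  imports Defs "HOL-Number_Theory.Cong"
begin

text \<open>
  A term \<open>X l\<close> that is a product of powers of 2 and 3 must be \<open>X 1\<close>. For even \<open>l = 2 * k\<close> the
  number \<open>X l = 2 * (X k)\<^sup>2 - 1\<close> is coprime to 6. For \<open>l = 3 * k\<close> the number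
  \<open>X l = X k * (4 * (X k)\<^sup>2 - 3)\<close> has an odd factor greater than 3 that is not divisible by 9.
  For the other \<open>l\<close>, the quotient \<open>X l div X 1\<close> is odd, and it is not divisible by 3: if 3 divides
  \<open>X 1\<close> it is \<open>\<plusminus>l\<close> modulo 3, and otherwise 3 does not even divide \<open>X l\<close>. Hence it is 1.
\<close>

section \<open>Uniqueness of coefficients over \<open>sqrt d\<close> and of exponents of 2 and
  3\<close>

lemma sqrt_combination_eq_iff:
  fixes d :: int
  assumes "d > 1" "\<not> is_square d"
  shows "real_of_int a + of_int b * sqrt (of_int d) = of_int a' + of_int b' * sqrt (of_int d)
           \<longleftrightarrow> a = a' \<and> b = b'"
proof
  assume eq: "real_of_int a + of_int b * sqrt (of_int d) = of_int a' + of_int b' * sqrt (of_int d)"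
  have "b = b'"
  proof (rule ccontr)
    assume "b \<noteq> b'"
    from eq have "real_of_int (a - a') = of_int (b' - b) * sqrt (of_int d)"
      by (simp add: algebra_simps)
    then have "(real_of_int (a - a'))\<^sup>2 = (of_int (b' - b) * sqrt (of_int d))\<^sup>2"
      by simp
    also have "\<dots> = (of_int (b' - b))\<^sup>2 * of_int d"
      using assms by (simp add: power_mult_distrib)
    finally have "real_of_int ((a - a')\<^sup>2) = of_int ((b' - b)\<^sup>2 * d)"
      by simp
    then have sq: "(a - a')\<^sup>2 = (b' - b)\<^sup>2 * d"
      by (simp only: of_int_eq_iff)
    \<comment> \<open>Divisibility of squares passes to the bases, so \<open>d\<close> would be the
      square of the integer quotient \<open>k\<close>.\<close>
    then have "(b' - b)\<^sup>2 dvd (a - a')\<^sup>2"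
      by simp
    then have "b' - b dvd a - a'"
      by simp
    then obtain k where "a - a' = (b' - b) * k" ..
    with sq \<open>b \<noteq> b'\<close> have "d = k\<^sup>2"
      by (simp add: power_mult_distrib)
    with assms(2) show False
      by simp
  qed
  with eq show "a = a' \<and> b = b'"
    by simp
qed simp

text \<open>Being coprime to 2 and to 3, \<open>r\<close> is coprime to the product it divides,
  hence a unit. Each case of the main argument ends by applying this to a suitable factor of
  \<open>X l\<close>.\<close>

lemma dvd_two_three_powers_imp_one:
  fixes r :: int
  assumes "r dvd 2 ^ a * 3 ^ b" "odd r" "\<not> 3 dvd r" "r > 0"
  shows "r = 1"
proof -
  have "coprime 3 r"
    using assms(3) by (intro prime_imp_coprime) simp_all
  then have "coprime r (2 ^ a * 3 ^ b)"
    using assms(2) by (simp add: coprime_commute)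
  with assms(1) have "is_unit r"
    using coprime_absorb_left by blast
  with assms(4) show ?thesis
    by simp
qed

text \<open>Solutions are triples, so equal indices must also force equal exponents. The exponent of
  2 is recovered as a multiplicity; cancelling leaves powers of 3.\<close>

lemma two_three_powers_eq_iff:
  "(2::int) ^ a * 3 ^ b = 2 ^ a' * 3 ^ b' \<longleftrightarrow> a = a' \<and> b = b'"
proof
  assume eq: "(2::int) ^ a * 3 ^ b = 2 ^ a' * 3 ^ b'"
  have mult: "multiplicity 2 ((2::int) ^ m * 3 ^ n) = m" for m n
  proof (rule multiplicity_eqI)
    show "(2::int) ^ m dvd 2 ^ m * 3 ^ n"
      by simp
    show "\<not> (2::int) ^ Suc m dvd 2 ^ m * 3 ^ n"
      by simp
  qed
  from arg_cong[OF eq, of "multiplicity 2"] have "a = a'"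
    by (simp only: mult)
  moreover from eq this have "(3::int) ^ b = 3 ^ b'"
    by (metis mult_cancel_left power_not_zero zero_neq_numeral)
  then have "b = b'"
    by (rule power_inject_exp[THEN iffD1, rotated]) simp
  ultimately show "a = a' \<and> b = b'" ..
qed blast

section \<open>Addition formulas, norm and growth of the Pell sequence\<close>

locale pell_sequence_nonsquare =
  fixes d :: int and X Y :: "nat \<Rightarrow> int"
  assumes d_gt_1: "d > 1" and nonsquare: "\<not> is_square d" and pell: "pell_sequence d X Y"
begin

lemma X_1_Y_1: "X 1 > 0" "Y 1 > 0" "(X 1)\<^sup>2 - d * (Y 1)\<^sup>2 = 1"
  using pell by (auto simp: pell_sequence_def pell_fundamental_def pell_solution_def)

lemma X_Y_power:
  "real_of_int (X l) + of_int (Y l) * sqrt (of_int d) = (of_int (X 1) + of_int (Y 1) * sqrt (of_int d)) ^ l"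
  using pell unfolding pell_sequence_def by blast

lemma X_0: "X 0 = 1" and Y_0: "Y 0 = 0"
proof -
  have "real_of_int (X 0) + of_int (Y 0) * sqrt (of_int d) = of_int 1 + of_int 0 * sqrt (of_int d)"
    using X_Y_power[of 0] by simp
  then show "X 0 = 1" "Y 0 = 0"
    unfolding sqrt_combination_eq_iff[OF d_gt_1 nonsquare] by blast+
qed

text \<open>Multiply the \<open>m\<close>-th and \<open>n\<close>-th powers of the fundamental unit
  and compare coefficients.\<close>

lemma X_add: "X (m + n) = X m * X n + d * Y m * Y n"
  and Y_add: "Y (m + n) = X m * Y n + Y m * X n"
proof -
  let ?s = "sqrt (real_of_int d)"
  have "real_of_int (X (m + n)) + of_int (Y (m + n)) * ?s
      = (of_int (X m) + of_int (Y m) * ?s) * (of_int (X n) + of_int (Y n) * ?s)"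
    unfolding X_Y_power[of "m + n"] X_Y_power[of m] X_Y_power[of n] by (rule power_add)
  also have "\<dots> = of_int (X m) * of_int (X n) + of_int (Y m) * of_int (Y n) * (?s * ?s)
      + (of_int (X m) * of_int (Y n) + of_int (Y m) * of_int (X n)) * ?s"
    by (simp add: algebra_simps)
  also have "?s * ?s = of_int d"
    using d_gt_1 by simp
  finally have "real_of_int (X (m + n)) + of_int (Y (m + n)) * ?s
      = of_int (X m * X n + d * Y m * Y n) + of_int (X m * Y n + Y m * X n) * ?s"
    by (simp add: algebra_simps)
  then show "X (m + n) = X m * X n + d * Y m * Y n" "Y (m + n) = X m * Y n + Y m * X n"
    unfolding sqrt_combination_eq_iff[OF d_gt_1 nonsquare] by blast+
qed

text \<open>The norm is multiplicative (Brahmagupta's identity), so it stays 1.\<close>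

lemma norm_eq_1: "(X n)\<^sup>2 - d * (Y n)\<^sup>2 = 1"
proof (induction n)
  case (Suc n)
  have "(X (Suc n))\<^sup>2 - d * (Y (Suc n))\<^sup>2
      = ((X n)\<^sup>2 - d * (Y n)\<^sup>2) * ((X 1)\<^sup>2 - d * (Y 1)\<^sup>2)"
    using X_add[of n 1] Y_add[of n 1] by (simp add: algebra_simps power2_eq_square)
  with Suc X_1_Y_1(3) show ?case
    by simp
qed (simp add: X_0 Y_0)

lemma X_double: "X (2 * k) = 2 * (X k)\<^sup>2 - 1"
  unfolding mult_2[of k] X_add using norm_eq_1[of k] by (simp add: power2_eq_square)

lemma X_triple: "X (3 * k) = X k * (4 * (X k)\<^sup>2 - 3)"
proof -
  have "X (3 * k) = X k * (X k)\<^sup>2 + 3 * X k * (d * (Y k)\<^sup>2)"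
    using X_add[of "k + k" k] X_add[of k k] Y_add[of k k]
    by (simp add: eval_nat_numeral algebra_simps)
  also have "d * (Y k)\<^sup>2 = (X k)\<^sup>2 - 1"
    using norm_eq_1[of k] by simp
  also have "X k * (X k)\<^sup>2 + 3 * X k * ((X k)\<^sup>2 - 1) = X k * (4 * (X k)\<^sup>2 - 3)"
    by (simp add: algebra_simps)
  finally show ?thesis .
qed

text \<open>Taking \<open>m = 1\<close> gives the usual recurrence, and \<open>m = 2\<close> a
  recurrence along the odd indices. The indices are written as sums to avoid subtraction on
  naturals.\<close>

lemma X_add_double: "X (n + 2 * m) = 2 * X m * X (n + m) - X n"
proof -
  have "Y (2 * m) = 2 * X m * Y m"
    unfolding mult_2[of m] Y_add by simp
  then have "X (n + 2 * m) = X n * (2 * (X m)\<^sup>2 - 1) + d * Y n * (2 * X m * Y m)"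
    unfolding X_add[of n "2 * m"] X_double by (rule arg_cong)
  also have "\<dots> = 2 * X m * (X n * X m + d * Y n * Y m) - X n"
    by (simp add: algebra_simps power2_eq_square)
  also have "X n * X m + d * Y n * Y m = X (n + m)"
    by (simp add: X_add)
  finally show ?thesis .
qed

lemma X_1_ge_2: "X 1 \<ge> 2"
proof (rule ccontr)
  assume "\<not> X 1 \<ge> 2"
  with X_1_Y_1(1) have "X 1 = 1"
    by simp
  with X_1_Y_1 d_gt_1 show False
    by simp
qed

text \<open>Proved jointly, since the addition formulas mix \<open>X\<close> and
  \<open>Y\<close>.\<close>

lemma X_pos: "X n > 0" and Y_nonneg: "Y n \<ge> 0"
proof (induction n)
  case (Suc n)
  {
    case 1
    show ?case
      using X_add[of n 1] Suc X_1_Y_1 d_gt_1 by (simp add: add_pos_nonneg)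
  next
    case 2
    show ?case
      using Y_add[of n 1] Suc X_1_Y_1 by simp
  }
qed (simp_all add: X_0 Y_0)

lemma strict_mono_X: "strict_mono X"
proof (rule strict_mono_Suc_iff[THEN iffD2], rule allI)
  fix n
  have "X n < X n * 2"
    using X_pos[of n] by simp
  also have "\<dots> \<le> X n * X 1"
    using X_1_ge_2 X_pos[of n] by simp
  also have "\<dots> \<le> X (Suc n)"
    using X_add[of n 1] Y_nonneg[of n] X_1_Y_1(2) d_gt_1 by simp
  finally show "X n < X (Suc n)" .
qed

section \<open>Residues modulo 2 and 3\<close>

lemma X_odd_index_quotient:
  obtains q where "X (2 * k + 1) = X 1 * q" "odd q"
    "3 dvd X 1 \<Longrightarrow> [q = (- 1) ^ k * int (2 * k + 1)] (mod 3)"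
proof -
  have "\<exists>q. X (2 * k + 1) = X 1 * q \<and> odd q \<and>
     (3 dvd X 1 \<longrightarrow> [q = (- 1) ^ k * int (2 * k + 1)] (mod 3))"
  proof (induction k rule: induct_nat_012)
    case 0
    show ?case
      by (intro exI[of _ 1]) simp
  next
    case 1
    have "3 dvd 4 * (X 1)\<^sup>2" if "3 dvd X 1"
      using that by (simp add: power2_eq_square)
    then have "[4 * (X 1)\<^sup>2 - 3 = - 3] (mod 3)" if "3 dvd X 1"
      using that by (simp add: cong_iff_dvd_diff)
    then show ?case
      using X_triple[of 1] by (intro exI[of _ "4 * (X 1)\<^sup>2 - 3"]) simp
  next
    case (ge2 n)
    then obtain p q where p: "X (2 * n + 1) = X 1 * p" "odd p"
        "3 dvd X 1 \<Longrightarrow> [p = (- 1) ^ n * int (2 * n + 1)] (mod 3)"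
      and q: "X (2 * Suc n + 1) = X 1 * q" "odd q"
        "3 dvd X 1 \<Longrightarrow> [q = (- 1) ^ Suc n * int (2 * Suc n + 1)] (mod 3)"
      by blast
    \<comment> \<open>The recurrence along odd indices preserves parity. When 3 divides
      \<open>X 1\<close>, \<open>X 2\<close> is -1 modulo 3, so it becomes
      \<open>r = - 2 * q - p\<close>, which \<open>(- 1) ^ k * (2 * k + 1)\<close>
      satisfies.\<close>
    let ?r = "2 * X 2 * q - p"
    have "X (2 * Suc (Suc n) + 1) = X 1 * ?r"
    proof -
      have "2 * Suc (Suc n) + 1 = 2 * n + 1 + 2 * 2" "2 * n + 1 + 2 = 2 * Suc n + 1"
        by simp_all
      then have "X (2 * Suc (Suc n) + 1) = 2 * X 2 * X (2 * Suc n + 1) - X (2 * n + 1)"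
        by (simp only: X_add_double)
      then show ?thesis
        unfolding p(1) q(1) by (simp add: algebra_simps)
    qed
    moreover have "odd ?r"
      using p(2) by simp
    moreover have "[?r = (- 1) ^ Suc (Suc n) * int (2 * Suc (Suc n) + 1)] (mod 3)" if "3 dvd X 1"
    proof -
      have "X 2 = 2 * (X 1)\<^sup>2 - 1"
        using X_double[of 1] by simp
      with that have "[X 2 = - 1] (mod 3)"
        by (simp add: cong_iff_dvd_diff power2_eq_square)
      then have "[?r = 2 * (- 1) * ((- 1) ^ Suc n * int (2 * Suc n + 1))
          - (- 1) ^ n * int (2 * n + 1)] (mod 3)"
        using that p(3) q(3) by (intro cong_diff cong_mult) auto
      then show ?thesis
        by (simp add: algebra_simps)
    qed
    ultimately show ?case
      by (intro exI[of _ ?r] conjI impI)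
  qed
  then show thesis
    using that by blast
qed

text \<open>Modulo 3 the square of \<open>X 1\<close> is 1, so the powers of \<open>X 1\<close> obey
  the same recurrence as \<open>X\<close> and agree with it.\<close>

lemma three_not_dvd_X:
  assumes "\<not> 3 dvd X 1"
  shows "\<not> 3 dvd X n"
proof -
  have sq: "[X 1 * X 1 = 1] (mod 3)"
  proof -
    have "X 1 mod 3 = 1 \<or> X 1 mod 3 = 2"
      using assms by presburger
    then show ?thesis
      by (auto simp: cong_def mod_mult_eq[symmetric, of "X 1"] simp del: One_nat_def)
  qed
  have "[X n = X 1 ^ n] (mod 3)"
  proof (induction n rule: induct_nat_012)
    case (ge2 n)
    have "[2 * X 1 * X (Suc n) - X n = 2 * X 1 * X 1 ^ Suc n - X 1 ^ n] (mod 3)"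
      using ge2 by (intro cong_diff cong_mult) auto
    also have "2 * X 1 * X 1 ^ Suc n - X 1 ^ n = (2 * (X 1 * X 1) - 1) * X 1 ^ n"
      by (simp add: algebra_simps)
    \<comment> \<open>The constant 1 is traded for \<open>X 1 * X 1\<close>, which turns the bracket
      into a single square.\<close>
    also have "[\<dots> = (2 * (X 1 * X 1) - X 1 * X 1) * X 1 ^ n] (mod 3)"
      using sq by (intro cong_diff cong_mult) (auto simp: cong_sym)
    also have "(2 * (X 1 * X 1) - X 1 * X 1) * X 1 ^ n = X 1 ^ Suc (Suc n)"
      by simp
    finally show ?case
      using X_add_double[of n 1] by simp
  qed (simp_all add: X_0)
  moreover have "\<not> 3 dvd X 1 ^ n"
    using assms prime_dvd_power[of 3 "X 1" n] by auto
  ultimately show ?thesis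
    by (simp add: cong_dvd_iff)
qed

section \<open>Terms composed of 2 and 3, and the conclusion\<close>

lemma X_two_three_powers_imp_index_1:
  assumes "l \<ge> 1" "X l = 2 ^ a * 3 ^ b"
  shows "l = 1"
proof (rule ccontr)
  assume "l \<noteq> 1"
  with assms(1) have "l > 1"
    by simp
  have gt: "X l > X 1" and pos: "X l > 0"
    using strict_mono_X \<open>l > 1\<close> X_pos by (simp_all add: strict_mono_less)
  consider (even) k where "l = 2 * k" | (triple) k where "l = 3 * k"
    | (other) k where "l = 2 * k + 1" "\<not> 3 dvd l"
    using evenE[of l] oddE[of l] dvdE[of 3 l] by metis
  then show False
  proof cases
    case even
    \<comment> \<open>Squares are 0 or 1 modulo 3, so \<open>2 * x\<^sup>2 - 1\<close> is 2 or
      1.\<close>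
    have "\<not> 3 dvd 2 * x\<^sup>2 - 1" for x :: int
    proof -
      have "x mod 3 = 0 \<or> x mod 3 = 1 \<or> x mod 3 = 2"
        by presburger
      then have "(x * x) mod 3 = 0 \<or> (x * x) mod 3 = 1"
        by (auto simp: mod_mult_eq[symmetric, of x])
      then show ?thesis
        unfolding power2_eq_square by presburger
    qed
    moreover have "X l = 2 * (X k)\<^sup>2 - 1"
      using even X_double by simp
    ultimately have "odd (X l)" "\<not> 3 dvd X l"
      by simp_all
    then have "X l = 1"
      using pos assms(2) by (intro dvd_two_three_powers_imp_one[of _ a b]) simp_all
    with gt X_1_ge_2 show False
      by simp
  next
    case triple
    define r where "r = 4 * (X k)\<^sup>2 - 3"
    have "k \<ge> 1"
      using triple \<open>l > 1\<close> by simp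
    then have "X 1 \<le> X k"
      using strict_mono_X by (simp add: strict_mono_less_eq)
    then have "2\<^sup>2 \<le> (X k)\<^sup>2"
      using X_1_ge_2 by (intro power_mono) auto
    \<comment> \<open>This excludes both \<open>r = 1\<close> and, when 3 divides \<open>r\<close>,
      the value \<open>r = 3\<close>.\<close>
    then have "r > 3"
      by (simp add: r_def)
    have r_dvd: "r dvd 2 ^ a * 3 ^ b"
      unfolding assms(2)[symmetric] triple X_triple r_def by (rule dvd_triv_right)
    have "odd r"
      by (simp add: r_def)
    show False
    proof (cases "3 dvd r")
      case False
      with dvd_two_three_powers_imp_one[OF r_dvd \<open>odd r\<close>] \<open>r > 3\<close> show False
        by simp
    next
      case True
      then obtain s where s: "r = 3 * s" ..
      \<comment> \<open>Then 3 divides \<open>X k\<close>, so \<open>r\<close> is -3 modulo 9 and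
        dividing out one 3 leaves a factor coprime to 3.\<close>
      have "3 dvd 4 * (X k)\<^sup>2"
        using True unfolding r_def by presburger
      then have "3 dvd (X k)\<^sup>2"
        by presburger
      then have "3 dvd X k"
        using prime_dvd_power[of 3 "X k" 2] by simp
      then obtain y where "X k = 3 * y" ..
      then have "s = 12 * y\<^sup>2 - 1"
        using s by (simp add: r_def power_mult_distrib)
      then have "\<not> 3 dvd s"
        by presburger
      moreover have "s dvd 2 ^ a * 3 ^ b"
        using r_dvd s by (metis dvd_mult_right)
      ultimately have "s = 1"
        using s \<open>odd r\<close> \<open>r > 3\<close> by (intro dvd_two_three_powers_imp_one[of s a b]) auto
      with s \<open>r > 3\<close> show False
        by simp
    qed
  next
    case other
    obtain q where q: "X l = X 1 * q" "odd q"
        "3 dvd X 1 \<Longrightarrow> [q = (- 1) ^ k * int l] (mod 3)"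
      using X_odd_index_quotient[of k] other(1) by metis
    have "\<not> 3 dvd q"
    proof (cases "3 dvd X 1")
      case True
      \<comment> \<open>The sign is a unit, so 3 would have to divide \<open>l\<close>.\<close>
      have "\<not> 3 dvd (- 1) ^ k * int l"
        using other(2) by (cases "even k") (simp_all, presburger+)
      with q(3)[OF True] show ?thesis
        by (simp add: cong_dvd_iff)
    next
      case False
      then show ?thesis
        using three_not_dvd_X[of l] q(1) by (metis dvd_mult)
    qed
    moreover have "q > 0"
      using q(1) pos X_pos[of 1] by (simp add: zero_less_mult_iff)
    ultimately have "q = 1"
      using q(2) assms(2)[symmetric] unfolding q(1)
      by (intro dvd_two_three_powers_imp_one[of q a b]) simp_all
    with q(1) gt show False
      by simp
  qed
qed

end

theorem theorem2p2:
  shows "\<not> (\<exists>(d::int) (X::nat \<Rightarrow> int) (Y::nat \<Rightarrow> int).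
            d > 1 \<and> \<not> is_square d \<and> pell_sequence d X Y \<and>
            (\<exists>s \<in> solutions_23 X. \<exists>t \<in> solutions_23 X. s \<noteq> t))"
proof
  assume "\<exists>(d::int) (X::nat \<Rightarrow> int) (Y::nat \<Rightarrow> int).
            d > 1 \<and> \<not> is_square d \<and> pell_sequence d X Y \<and>
            (\<exists>s \<in> solutions_23 X. \<exists>t \<in> solutions_23 X. s \<noteq> t)"
  then obtain d X Y s t where "d > 1" "\<not> is_square d" "pell_sequence d X Y"
    and st: "s \<in> solutions_23 X" "t \<in> solutions_23 X" "s \<noteq> t"
    by blast
  then interpret pell_sequence_nonsquare d X Y
    by unfold_locales
  obtain l a b l' a' b' where eqs: "s = (l, a, b)" "t = (l', a', b')"
    by (metis prod_cases3)
  with st have "l \<ge> 1" "X l = 2 ^ a * 3 ^ b" "l' \<ge> 1" "X l' = 2 ^ a' * 3 ^ b'"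
    by (auto simp: solutions_23_def)
  moreover from this have "l = 1" "l' = 1"
    using X_two_three_powers_imp_index_1 by blast+
  ultimately show False
    \<comment> \<open>Both products equal \<open>X 1\<close>, so the exponents agree as
      well.\<close>
    using eqs st(3) two_three_powers_eq_iff[of a b a' b'] by simp
qed

end
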